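(* The map $p\Phi:\mathcal{O}P^2\to p\mathbb{O}P^2$ defined on points and lines by $$(x,y)\mapsto(\tau^{2}(x),y),\quad (s)\mapsto(\tau(s)),\quad(\infty)\mapsto(\infty),\quad [s,t]\mapsto[\tau(s),t],\quad[c]\mapsto[\tau^{2}(c)],\quad[\infty]\mapsto[\infty]$$ is an isomorphism of projective planes from the Okubic projective plane to the para-octonionic projective plane; that is, it is bijective on points and on lines, and a point is incident to a line if and only if their images are incident.
   Context: The real Okubo algebra $\mathcal{O}$ is the 8-dimensional real vector space of $3\times 3$ complex Hermitian traceless matrices with bilinear product $x*y=\mu\,xy+\overline{\mu}\,yx-\frac13\mathrm{Tr}(xy)\,I$, where $\mu=\frac16(3+\mathrm{i}\sqrt3)$, and norm $n(x)=\frac16\mathrm{Tr}(x^2)$, with polar form $\langle x,y\rangle=n(x+y)-n(x)-n(y)$. The element $e=\mathrm{diag}(2,-1,-1)$ is an idempotent, $e*e=e$, with $n(e)=1$. On the same vector space the product $x\cdot y=(e*x)*(y*e)$ with the same norm $n$ gives a unital (unit $e$) composition division algebra of dimension 8, hence the octonions $\mathbb{O}$, whose conjugation is $\overline{x}=\langle x,e\rangle e-x$. The para-octonions $p\mathbb{O}$ are the same vector space with product $x\bullet y=\overline{x}\cdot\overline{y}$. Define the linear map $\tau(x)=\langle x,e\rangle e-x*e$. For $(A,\star)=(\mathcal{O},* )$ or $(p\mathbb{O},\bullet)$ the projective plane over $A$ is described in affine coordinates as follows. Points: affine points $(x,y)\in A^2$; points at infinity $(s)$, $s\in A$; and $(\infty)$.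 Lines: $[s,t]=\{(x,s\star x+t):x\in A\}\cup\{(s)\}$ for $s,t\in A$; $[c]=(\{c\}\times A)\cup\{(\infty)\}$ for $c\in A$; $[\infty]=\{(s):s\in A\}\cup\{(\infty)\}$. Incidence is membership. $\mathcal{O}P^2$ denotes this plane for $(\mathcal{O},* )$ and $p\mathbb{O}P^2$ this plane for $(p\mathbb{O},\bullet)$. *)

theory Defs
  imports "HOL-Analysis.Analysis"
begin

section \<open>The real Okubo algebra\<close>

type_synonym mat3 = "complex ^ 3 ^ 3"

definition hermitian :: "mat3 \<Rightarrow> bool" where
  "hermitian x \<longleftrightarrow> (\<forall>i j. x $ i $ j = cnj (x $ j $ i))"

definition okubo :: "mat3 set" where
  "okubo = {x. hermitian x \<and> trace x = 0}"

definition okubo_mu :: complex where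
  "okubo_mu = (3 + \<i> * complex_of_real (sqrt 3)) / 6"

definition cscale :: "complex \<Rightarrow> mat3 \<Rightarrow> mat3" where
  "cscale c x = (\<chi> i j. c * x $ i $ j)"

definition okubo_mult :: "mat3 \<Rightarrow> mat3 \<Rightarrow> mat3" where
  "okubo_mult x y =
     cscale okubo_mu (x ** y) + cscale (cnj okubo_mu) (y ** x)
       - cscale (trace (x ** y) / 3) (mat 1)"

text \<open>For Hermitian \<open>x\<close> the trace of \<open>x ** x\<close> is real, so taking the real part
  only changes the type.\<close>

definition okubo_norm :: "mat3 \<Rightarrow> real" where
  "okubo_norm x = Re (trace (x ** x)) / 6"

definition okubo_polar :: "mat3 \<Rightarrow> mat3 \<Rightarrow> real" where
  "okubo_polar x y = okubo_norm (x + y) - okubo_norm x - okubo_norm y"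

definition okubo_e :: mat3 where
  "okubo_e = (\<chi> i j. if i = j then (if i = 1 then 2 else - 1) else 0)"

section \<open>Octonions and para-octonions on the same vector space\<close>

definition oct_mult :: "mat3 \<Rightarrow> mat3 \<Rightarrow> mat3" where
  "oct_mult x y = okubo_mult (okubo_mult okubo_e x) (okubo_mult y okubo_e)"

definition oct_conj :: "mat3 \<Rightarrow> mat3" where
  "oct_conj x = okubo_polar x okubo_e *\<^sub>R okubo_e - x"

definition para_oct_mult :: "mat3 \<Rightarrow> mat3 \<Rightarrow> mat3" where
  "para_oct_mult x y = oct_mult (oct_conj x) (oct_conj y)"

definition okubo_tau :: "mat3 \<Rightarrow> mat3" where
  "okubo_tau x = okubo_polar x okubo_e *\<^sub>R okubo_e - okubo_mult x okubo_e"

section \<open>The plane over an algebra, in affine coordinates\<close>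

datatype 'a plane_point = Affine 'a 'a | Slope 'a | Vert_Inf

text \<open>Throughout, \<open>A\<close> is the carrier of the algebra and \<open>m\<close> its product.
  Lines are sets of points, and incidence is membership.\<close>

definition plane_points :: "'a set \<Rightarrow> 'a plane_point set" where
  "plane_points A = {Affine x y | x y. x \<in> A \<and> y \<in> A} \<union> {Slope s | s. s \<in> A} \<union> {Vert_Inf}"

definition slope_line ::
  "'a::plus set \<Rightarrow> ('a \<Rightarrow> 'a \<Rightarrow> 'a) \<Rightarrow> 'a \<Rightarrow> 'a \<Rightarrow> 'a plane_point set" where
  "slope_line A m s t = {Affine x (m s x + t) | x. x \<in> A} \<union> {Slope s}"

definition vert_line :: "'a set \<Rightarrow> 'a \<Rightarrow> 'a plane_point set" where
  "vert_line A c = {Affine c y | y. y \<in> A} \<union> {Vert_Inf}"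

definition inf_line :: "'a set \<Rightarrow> 'a plane_point set" where
  "inf_line A = {Slope s | s. s \<in> A} \<union> {Vert_Inf}"

definition plane_lines ::
  "'a::plus set \<Rightarrow> ('a \<Rightarrow> 'a \<Rightarrow> 'a) \<Rightarrow> 'a plane_point set set" where
  "plane_lines A m =
     {slope_line A m s t | s t. s \<in> A \<and> t \<in> A} \<union> {vert_line A c | c. c \<in> A} \<union> {inf_line A}"

definition plane_isomorphism ::
  "'p set \<Rightarrow> 'p set set \<Rightarrow> 'q set \<Rightarrow> 'q set set \<Rightarrow> ('p \<Rightarrow> 'q) \<Rightarrow> ('p set \<Rightarrow> 'q set) \<Rightarrow> bool" where
  "plane_isomorphism P L P' L' f g \<longleftrightarrow>
     bij_betw f P P' \<and> bij_betw g L L' \<and>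
     (\<forall>p\<in>P. \<forall>l\<in>L. p \<in> l \<longleftrightarrow> f p \<in> g l)"

section \<open>The map from the Okubic plane to the para-octonionic plane\<close>

fun pPhi_point :: "mat3 plane_point \<Rightarrow> mat3 plane_point" where
  "pPhi_point (Affine x y) = Affine (okubo_tau (okubo_tau x)) y"
| "pPhi_point (Slope s) = Slope (okubo_tau s)"
| "pPhi_point Vert_Inf = Vert_Inf"

text \<open>The map on lines is given by the coordinates of a line, while lines are sets of
  points. Hence it is defined as a graph; coordinates are determined by the line
  (\<open>s\<close> by its point at infinity, \<open>t\<close> by its point over \<open>0\<close>, \<open>c\<close> by its affine points),
  which makes the description unique.\<close>

definition pPhi_line :: "mat3 plane_point set \<Rightarrow> mat3 plane_point set" where
  "pPhi_line l = (THE l'.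
     (\<exists>s\<in>okubo. \<exists>t\<in>okubo. l = slope_line okubo okubo_mult s t \<and>
        l' = slope_line okubo para_oct_mult (okubo_tau s) t) \<or>
     (\<exists>c\<in>okubo. l = vert_line okubo c \<and> l' = vert_line okubo (okubo_tau (okubo_tau c))) \<or>
     (l = inf_line okubo \<and> l' = inf_line okubo))"

end

theory Submission
  imports Defs
begin

text \<open>
  The theorem is the coordinate form of an isotopy between the two products,
  \<open>\<tau>(s) \<bullet> \<tau>\<^sup>2(x) = s * x\<close> (\<open>para_oct_mult_tau\<close>): by it the point map sends
  the graph of \<open>x \<mapsto> s * x + t\<close> onto the graph of
  \<open>x' \<mapsto> \<tau>(s) \<bullet> x' + t\<close>, so the line map is nothing but
  the direct image of lines under the point map (\<open>pPhi_line_eq_image\<close>), and incidence is preserved in both directions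
  as soon as the point map is injective (\<open>plane_isomorphism_image\<close>).

  The isotopy has two sources. By definition of the products,
  \<open>a \<bullet> b = (e * conj a) * (conj b * e)\<close>, and
  \<open>conj (\<tau> x) = x * e\<close> because \<open>\<tau>\<close> preserves the inner product
  with \<open>e\<close> (\<open>oct_conj_tau\<close>). Thus
  \<open>\<tau>(s) \<bullet> \<tau>\<^sup>2(x) = (e * (s * e)) * ((\<tau> x * e) * e)\<close>.
  The first factor is \<open>s\<close>, an instance of the law \<open>y * (x * y) = n(y) x\<close>
  with \<open>n(e) = 1\<close> (\<open>okubo_mult_e_sandwich\<close>). For the second, right multiplication by \<open>e\<close> is
  \<open>\<tau>\<close> followed by the octonion conjugation; these commute and conjugation
  is an involution, so multiplying twice gives \<open>\<tau>\<^sup>2\<close>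
  (\<open>okubo_mult_e_right_twice\<close>), and it remains that
  \<open>\<tau>\<^sup>3 = 1\<close>. This last fact is visible on matrices: \<open>\<tau>\<close>
  is conjugation by the unitary matrix \<open>diag(\<omega>, 1, 1)\<close>, where \<open>\<omega>\<close>
  is a primitive cube root of unity (\<open>okubo_tau_entries\<close>). It also shows that \<open>\<tau>\<close> is a bijection.
\<close>

section \<open>Multiplication by the idempotent and the automorphism tau\<close>

definition okubo_omega :: complex where
  "okubo_omega = okubo_mu - 2 * cnj okubo_mu"

lemma okubo_mu_add_cnj: "okubo_mu + cnj okubo_mu = 1"
  by (simp add: okubo_mu_def complex_eq_iff)

lemma okubo_omega_unit: "okubo_omega * cnj okubo_omega = 1"
  by (simp add: okubo_omega_def okubo_mu_def complex_eq_iff field_simps)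

lemma okubo_omega_cube: "okubo_omega * okubo_omega * okubo_omega = 1"
  by (simp add: okubo_omega_def okubo_mu_def complex_eq_iff field_simps)

lemmas mat3_entry_simps =
  vec_eq_iff forall_3 sum_3 matrix_matrix_mult_def trace_def mat_def cscale_def okubo_e_def

text \<open>The symmetry condition is oriented so that rewriting with it terminates.\<close>

lemma okubo_iff:
  "x \<in> okubo \<longleftrightarrow>
     (\<forall>i j. cnj (x $ i $ j) = x $ j $ i) \<and> x $ 1 $ 1 + x $ 2 $ 2 + x $ 3 $ 3 = 0"
proof -
  have "hermitian x \<longleftrightarrow> (\<forall>i j. cnj (x $ i $ j) = x $ j $ i)"
    unfolding hermitian_def by metis
  then show ?thesis
    by (simp add: okubo_def trace_def sum_3)
qed

lemma okubo_trace_zero: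
  assumes "x \<in> okubo"
  shows "x$1$1 = - x$2$2 - x$3$3"
proof -
  have "x$1$1 + x$2$2 + x$3$3 = 0"
    using assms by (simp add: okubo_iff)
  then show ?thesis
    by algebra
qed

text \<open>Since \<open>e\<close> is diagonal, \<open>x * e\<close> multiplies the entry in row \<open>i\<close> and column
  \<open>j\<close> by \<open>\<mu> e\<^sub>j + cnj \<mu> e\<^sub>i\<close>, up to the trace term. That term is the
  multiple \<open>x\<^sub>1\<^sub>1\<close> of the identity because \<open>Tr (x e) = 3 x\<^sub>1\<^sub>1\<close> for
  traceless \<open>x\<close>; on the diagonal it results in the exchange of \<open>x\<^sub>2\<^sub>2\<close> and
  \<open>x\<^sub>3\<^sub>3\<close>.\<close>

lemma okubo_mult_e_right_entries:
  assumes "x \<in> okubo"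
  shows "okubo_mult x okubo_e =
    vector [vector [x$1$1, - okubo_omega * x$1$2, - okubo_omega * x$1$3],
            vector [- cnj okubo_omega * x$2$1, x$3$3, - x$2$3],
            vector [- cnj okubo_omega * x$3$1, - x$3$2, x$2$2]]"
proof -
  note tr = okubo_trace_zero[OF assms]
  have c: "cnj okubo_mu = 1 - okubo_mu"
    using okubo_mu_add_cnj by (simp add: algebra_simps)
  show ?thesis
    by (simp add: mat3_entry_simps okubo_mult_def okubo_omega_def tr c algebra_simps
        add_divide_distrib diff_divide_distrib)
qed

lemma okubo_mult_e_left_entries:
  assumes "x \<in> okubo"
  shows "okubo_mult okubo_e x =
    vector [vector [x$1$1, - cnj okubo_omega * x$1$2, - cnj okubo_omega * x$1$3],
            vector [- okubo_omega * x$2$1, x$3$3, - x$2$3],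
            vector [- okubo_omega * x$3$1, - x$3$2, x$2$2]]"
proof -
  note tr = okubo_trace_zero[OF assms]
  have c: "cnj okubo_mu = 1 - okubo_mu"
    using okubo_mu_add_cnj by (simp add: algebra_simps)
  show ?thesis
    by (simp add: mat3_entry_simps okubo_mult_def okubo_omega_def tr c algebra_simps
        add_divide_distrib diff_divide_distrib)
qed

lemma okubo_polar_e:
  assumes "x \<in> okubo"
  shows "complex_of_real (okubo_polar x okubo_e) = x$1$1"
proof -
  have "Re (x$1$1) = - Re (x$2$2) - Re (x$3$3)"
    using okubo_trace_zero[OF assms] by simp
  moreover have "cnj (x$1$1) = x$1$1"
    using assms by (simp add: okubo_iff)
  ultimately show ?thesis
    by (simp add: okubo_polar_def okubo_norm_def mat3_entry_simps complex_eq_iff field_simps)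
qed

text \<open>The right-hand side is \<open>D x D\<^sup>-\<^sup>1\<close> with \<open>D = diag(\<omega>, 1, 1)\<close>.
  Adding \<open>x\<^sub>1\<^sub>1 e\<close> and changing the sign cancels the exchange of the diagonal
  entries and the signs in \<open>x * e\<close>.\<close>

lemma okubo_tau_entries:
  assumes "x \<in> okubo"
  shows "okubo_tau x =
    vector [vector [x$1$1, okubo_omega * x$1$2, okubo_omega * x$1$3],
            vector [cnj okubo_omega * x$2$1, x$2$2, x$2$3],
            vector [cnj okubo_omega * x$3$1, x$3$2, x$3$3]]"
proof -
  have "(okubo_polar x okubo_e *\<^sub>R okubo_e) $ i $ j =
      (if i = j then (if i = 1 then 2 else - 1) * x$1$1 else 0)" for i j
    unfolding vector_scaleR_component unfolding scaleR_conv_of_real okubo_polar_e[OF assms]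
    by (simp add: okubo_e_def)
  then show ?thesis
    by (simp add: okubo_tau_def okubo_mult_e_right_entries[OF assms]
        vec_eq_iff forall_3 del: vector_scaleR_component) (simp add: okubo_trace_zero[OF assms])
qed

lemma okubo_tau_in: "x \<in> okubo \<Longrightarrow> okubo_tau x \<in> okubo"
  using okubo_tau_entries[of x] by (auto simp: okubo_iff forall_3)

lemma okubo_mult_e_right_in: "x \<in> okubo \<Longrightarrow> okubo_mult x okubo_e \<in> okubo"
  using okubo_mult_e_right_entries[of x] by (auto simp: okubo_iff forall_3 algebra_simps)

lemma okubo_tau_cube:
  assumes "x \<in> okubo"
  shows "okubo_tau (okubo_tau (okubo_tau x)) = x"
proof -
  have "cnj okubo_omega * cnj okubo_omega * cnj okubo_omega = 1"
    using arg_cong[OF okubo_omega_cube, of cnj] by simp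
  then have powers: "okubo_omega * (okubo_omega * (okubo_omega * z)) = z"
    "cnj okubo_omega * (cnj okubo_omega * (cnj okubo_omega * z)) = z" for z
    using okubo_omega_cube by (metis mult.assoc mult_1)+
  show ?thesis
    unfolding okubo_tau_entries[OF okubo_tau_in[OF okubo_tau_in[OF assms]]]
    unfolding okubo_tau_entries[OF okubo_tau_in[OF assms]]
    unfolding okubo_tau_entries[OF assms]
    by (simp add: vec_eq_iff forall_3 powers)
qed

text \<open>Right multiplication by \<open>e\<close> and \<open>\<tau>\<close> differ only by the octonion
  conjugation, which on entries exchanges \<open>x\<^sub>2\<^sub>2\<close> with \<open>x\<^sub>3\<^sub>3\<close> and
  negates everything off the diagonal. It is an involution commuting with the phases of
  \<open>\<tau>\<close>, so it disappears from the square.\<close>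

lemma okubo_mult_e_right_twice:
  assumes "x \<in> okubo"
  shows "okubo_mult (okubo_mult x okubo_e) okubo_e = okubo_tau (okubo_tau x)"
  unfolding okubo_mult_e_right_entries[OF okubo_mult_e_right_in[OF assms]]
    okubo_tau_entries[OF okubo_tau_in[OF assms]]
  unfolding okubo_mult_e_right_entries[OF assms] okubo_tau_entries[OF assms]
  by (simp add: vec_eq_iff forall_3)

text \<open>Left multiplication by \<open>e\<close> has the conjugate phases of right multiplication, so the two
  are mutually inverse. This is the law \<open>y * (x * y) = n(y) x\<close> at \<open>y = e\<close>.\<close>

lemma okubo_mult_e_sandwich:
  assumes "x \<in> okubo"
  shows "okubo_mult okubo_e (okubo_mult x okubo_e) = x"
proof -
  have cancel: "cnj okubo_omega * (okubo_omega * z) = z" "okubo_omega * (cnj okubo_omega * z) = z" for z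
    using okubo_omega_unit by (metis mult.assoc mult.commute mult_1)+
  show ?thesis
    unfolding okubo_mult_e_left_entries[OF okubo_mult_e_right_in[OF assms]]
    unfolding okubo_mult_e_right_entries[OF assms]
    by (simp add: vec_eq_iff forall_3 cancel)
qed

text \<open>Both \<open>\<tau>\<close> and the conjugation are of the form \<open>x \<mapsto> \<langle>x, e\<rangle> e - \<dots>\<close>, so the
  multiples of \<open>e\<close> cancel once \<open>\<langle>\<tau> x, e\<rangle> = \<langle>x, e\<rangle>\<close> is known; the latter holds as both
  are the entry \<open>x\<^sub>1\<^sub>1\<close>.\<close>

lemma oct_conj_tau:
  assumes "x \<in> okubo"
  shows "oct_conj (okubo_tau x) = okubo_mult x okubo_e"
proof -
  have "complex_of_real (okubo_polar (okubo_tau x) okubo_e) = complex_of_real (okubo_polar x okubo_e)"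
    by (simp only: okubo_polar_e[OF assms] okubo_polar_e[OF okubo_tau_in[OF assms]])
      (simp add: okubo_tau_entries[OF assms])
  then have "okubo_polar (okubo_tau x) okubo_e = okubo_polar x okubo_e"
    by (simp only: of_real_eq_iff)
  then show ?thesis
    by (simp add: oct_conj_def) (simp add: okubo_tau_def)
qed

text \<open>This is the isotopy that makes the point map send lines to lines. The powers of
  \<open>\<tau>\<close> differ because the conjugates in the para-octonionic product turn into right
  multiplications by \<open>e\<close>: the left argument meets one, undone by \<open>e\<close> on the left, the right
  argument meets two, which amount to \<open>\<tau>\<^sup>2\<close> and need one further
  \<open>\<tau>\<close> to vanish.\<close>

lemma para_oct_mult_tau:
  assumes s: "s \<in> okubo" and x: "x \<in> okubo"
  shows "para_oct_mult (okubo_tau s) (okubo_tau (okubo_tau x)) = okubo_mult s x"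
proof -
  have "para_oct_mult (okubo_tau s) (okubo_tau (okubo_tau x)) =
      okubo_mult (okubo_mult okubo_e (okubo_mult s okubo_e))
        (okubo_mult (okubo_mult (okubo_tau x) okubo_e) okubo_e)"
    by (simp add: para_oct_mult_def oct_mult_def oct_conj_tau okubo_tau_in s x)
  also have "\<dots> = okubo_mult s (okubo_tau (okubo_tau (okubo_tau x)))"
    by (simp only: okubo_mult_e_sandwich[OF s] okubo_mult_e_right_twice[OF okubo_tau_in[OF x]])
  also have "\<dots> = okubo_mult s x"
    by (simp only: okubo_tau_cube[OF x])
  finally show ?thesis .
qed

lemma bij_betw_okubo_tau: "bij_betw okubo_tau okubo okubo"
  by (rule bij_betw_byWitness[where f' = "\<lambda>x. okubo_tau (okubo_tau x)"])
    (auto simp: okubo_tau_cube okubo_tau_in)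

lemma okubo_add_in:
  assumes x: "x \<in> okubo" and y: "y \<in> okubo"
  shows "x + y \<in> okubo"
proof -
  have "cnj ((x + y) $ i $ j) = (x + y) $ j $ i" for i j
    using x y by (simp add: okubo_iff)
  moreover have "(x + y)$1$1 + (x + y)$2$2 + (x + y)$3$3 = 0"
    by (simp add: okubo_trace_zero[OF x] okubo_trace_zero[OF y])
  ultimately show ?thesis
    unfolding okubo_iff by blast
qed

text \<open>Hermitian conjugation reverses matrix products and so exchanges the two summands of
  \<open>\<mu> x y + cnj \<mu> y x\<close>; the trace term removes exactly the trace, because
  \<open>\<mu> + cnj \<mu> = 1\<close>. Closure guarantees that lines consist of points of the plane.\<close>

lemma okubo_mult_in:
  assumes x: "x \<in> okubo" and y: "y \<in> okubo"
  shows "okubo_mult x y \<in> okubo"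
proof -
  have cnj_mult: "cnj ((a ** b) $ i $ j) = (b ** a) $ j $ i" if "a \<in> okubo" "b \<in> okubo" for a b i j
  proof -
    have "cnj (a $ i $ k) = a $ k $ i" "cnj (b $ k $ j) = b $ j $ k" for k
      using that by (metis okubo_iff)+
    then show ?thesis
      by (simp add: matrix_matrix_mult_def mult.commute)
  qed
  have "cnj (trace (x ** y)) = trace (y ** x)"
    by (simp add: trace_def cnj_mult x y)
  then have real: "cnj (trace (x ** y)) = trace (x ** y)"
    by (simp only: trace_mul_sym[of y x])
  have "hermitian (okubo_mult x y)"
    by (simp add: hermitian_def okubo_mult_def cscale_def mat_def cnj_mult x y real)
  moreover have "trace (okubo_mult x y) = (okubo_mu + cnj okubo_mu) * trace (x ** y) - trace (x ** y)"
  proof -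
    have scale: "trace (cscale c z) = c * trace z" for c z
      by (simp add: trace_def cscale_def sum_distrib_left)
    show ?thesis
      by (simp add: okubo_mult_def trace_add trace_sub scale trace_I trace_mul_sym[of y x] distrib_right)
  qed
  ultimately show ?thesis
    by (simp add: okubo_def okubo_mu_add_cnj)
qed

section \<open>Isomorphism of the planes\<close>

text \<open>When the line map is the direct image under an injective point map, preservation of incidence
  is automatic in both directions.\<close>

lemma plane_isomorphism_image:
  assumes F: "bij_betw F P P'"
    and sub: "\<And>l. l \<in> L \<Longrightarrow> l \<subseteq> P"
    and G: "\<And>l. l \<in> L \<Longrightarrow> G l = F ` l"
    and onto: "(\<lambda>l. F ` l) ` L = L'"
  shows "plane_isomorphism P L P' L' F G"
proof -
  have inj: "inj_on F P"
    using F by (rule bij_betw_imp_inj_on)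
  have "inj_on G L"
    by (rule inj_onI) (metis G sub inj inj_on_image_eq_iff)
  moreover have "G ` L = L'"
    using onto G by (simp add: image_def)
  moreover have "p \<in> l \<longleftrightarrow> F p \<in> G l" if "p \<in> P" "l \<in> L" for p l
    using that by (simp add: G inj_on_image_mem_iff[OF inj _ sub])
  ultimately show ?thesis
    using F by (simp add: plane_isomorphism_def bij_betw_def)
qed

lemma bij_betw_pPhi_point: "bij_betw pPhi_point (plane_points okubo) (plane_points okubo)"
proof (rule bij_betw_byWitness)
  let ?inv = "\<lambda>p. case p of Affine x y \<Rightarrow> Affine (okubo_tau x) y
    | Slope s \<Rightarrow> Slope (okubo_tau (okubo_tau s)) | Vert_Inf \<Rightarrow> Vert_Inf"
  show "\<forall>p\<in>plane_points okubo. ?inv (pPhi_point p) = p"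
    "\<forall>p\<in>plane_points okubo. pPhi_point (?inv p) = p"
    "pPhi_point ` plane_points okubo \<subseteq> plane_points okubo"
    "?inv ` plane_points okubo \<subseteq> plane_points okubo"
    by (auto simp: plane_points_def okubo_tau_cube okubo_tau_in)
qed

lemma pPhi_point_slope_line:
  assumes "s \<in> okubo"
  shows "pPhi_point ` slope_line okubo okubo_mult s t =
    slope_line okubo para_oct_mult (okubo_tau s) t"
proof -
  let ?g = "\<lambda>x. okubo_tau (okubo_tau x)"
  have slope_line_image: "slope_line A m s t = (\<lambda>x. Affine x (m s x + t)) ` A \<union> {Slope s}"
    for A :: "mat3 set" and m s t
    by (auto simp: slope_line_def)
  have "?g ` okubo = okubo_tau ` okubo_tau ` okubo"
    by (rule image_image[symmetric])
  then have g: "?g ` okubo = okubo"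
    by (simp only: bij_betw_imp_surj_on[OF bij_betw_okubo_tau])
  have "(\<lambda>x. Affine x (para_oct_mult (okubo_tau s) x + t)) ` ?g ` okubo =
      (\<lambda>x. Affine (?g x) (okubo_mult s x + t)) ` okubo"
    unfolding image_image by (rule image_cong) (simp_all add: para_oct_mult_tau assms)
  then show ?thesis
    by (simp add: g slope_line_image image_Un image_image)
qed

lemma pPhi_point_vert_line:
  "pPhi_point ` vert_line okubo c = vert_line okubo (okubo_tau (okubo_tau c))"
  by (auto simp: vert_line_def image_def)

lemma pPhi_point_inf_line: "pPhi_point ` inf_line okubo = inf_line okubo"
proof -
  have "pPhi_point ` inf_line okubo = Slope ` okubo_tau ` okubo \<union> {Vert_Inf}"
    by (auto simp: inf_line_def image_def)
  then show ?thesis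
    using bij_betw_imp_surj_on[OF bij_betw_okubo_tau] by (auto simp: inf_line_def)
qed

lemma okubo_lines_cases:
  assumes "l \<in> plane_lines okubo m"
  obtains (slope) s t where "s \<in> okubo" "t \<in> okubo" "l = slope_line okubo m s t"
  | (vert) c where "c \<in> okubo" "l = vert_line okubo c"
  | (inf) "l = inf_line okubo"
  using assms unfolding plane_lines_def by blast

text \<open>Whatever coordinates describe the line, the candidate image is the direct image, so the
  description in \<open>pPhi_line\<close> is unique without comparing coordinates.\<close>

lemma pPhi_line_eq_image:
  assumes "l \<in> plane_lines okubo okubo_mult"
  shows "pPhi_line l = pPhi_point ` l"
  unfolding pPhi_line_def
proof (rule the_equality, goal_cases)
  case 1
  from assms show ?case
  proof (cases rule: okubo_lines_cases)
    case slope
    then show ?thesis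
      using pPhi_point_slope_line by metis
  next
    case vert
    then show ?thesis
      using pPhi_point_vert_line by metis
  next
    case inf
    then show ?thesis
      using pPhi_point_inf_line by metis
  qed
next
  case (2 l')
  then show ?case
    by (elim disjE bexE conjE)
      (simp_all only: pPhi_point_slope_line pPhi_point_vert_line pPhi_point_inf_line)
qed

lemma pPhi_point_image_lines:
  "(\<lambda>l. pPhi_point ` l) ` plane_lines okubo okubo_mult = plane_lines okubo para_oct_mult"
proof (intro equalityI subsetI)
  fix l' assume "l' \<in> (\<lambda>l. pPhi_point ` l) ` plane_lines okubo okubo_mult"
  then obtain l where l: "l \<in> plane_lines okubo okubo_mult" and l': "l' = pPhi_point ` l"
    by blast
  from l show "l' \<in> plane_lines okubo para_oct_mult"
  proof (cases rule: okubo_lines_cases)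
    case (slope s t)
    then have "l' = slope_line okubo para_oct_mult (okubo_tau s) t"
      by (simp add: l' pPhi_point_slope_line)
    then show ?thesis
      unfolding plane_lines_def using slope okubo_tau_in by blast
  next
    case (vert c)
    then have "l' = vert_line okubo (okubo_tau (okubo_tau c))"
      by (simp add: l' pPhi_point_vert_line)
    then show ?thesis
      unfolding plane_lines_def using vert okubo_tau_in by blast
  next
    case inf
    then show ?thesis
      by (simp add: l' pPhi_point_inf_line plane_lines_def)
  qed
next
  fix l' assume "l' \<in> plane_lines okubo para_oct_mult"
  then show "l' \<in> (\<lambda>l. pPhi_point ` l) ` plane_lines okubo okubo_mult"
  proof (cases rule: okubo_lines_cases)
    case (slope s t)
    let ?s = "okubo_tau (okubo_tau s)"
    have "?s \<in> okubo"
      using slope by (simp add: okubo_tau_in)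
    moreover from this have "pPhi_point ` slope_line okubo okubo_mult ?s t = l'"
      using slope by (simp add: pPhi_point_slope_line okubo_tau_cube)
    ultimately show ?thesis
      unfolding plane_lines_def using slope by blast
  next
    case (vert c)
    let ?c = "okubo_tau c"
    have "?c \<in> okubo"
      using vert by (simp add: okubo_tau_in)
    moreover have "pPhi_point ` vert_line okubo ?c = l'"
      using vert by (simp add: pPhi_point_vert_line okubo_tau_cube)
    ultimately show ?thesis
      unfolding plane_lines_def by blast
  next
    case inf
    then have "pPhi_point ` inf_line okubo = l'"
      by (simp add: pPhi_point_inf_line)
    then show ?thesis
      unfolding plane_lines_def by blast
  qed
qed

lemma plane_lines_subset:
  "l \<in> plane_lines okubo okubo_mult \<Longrightarrow> l \<subseteq> plane_points okubo"
  by (auto simp: plane_lines_def plane_points_def slope_line_def vert_line_def inf_line_def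
      okubo_mult_in okubo_add_in)

theorem mainTheorem3:
  shows "(\<forall>s\<in>okubo. \<forall>t\<in>okubo.
            pPhi_line (slope_line okubo okubo_mult s t)
              = slope_line okubo para_oct_mult (okubo_tau s) t)
       \<and> (\<forall>c\<in>okubo.
            pPhi_line (vert_line okubo c) = vert_line okubo (okubo_tau (okubo_tau c)))
       \<and> pPhi_line (inf_line okubo) = inf_line okubo
       \<and> plane_isomorphism
            (plane_points okubo) (plane_lines okubo okubo_mult)
            (plane_points okubo) (plane_lines okubo para_oct_mult)
            pPhi_point pPhi_line"
proof (intro conjI ballI)
  fix s t assume "s \<in> okubo" "t \<in> okubo"
  moreover from this have "slope_line okubo okubo_mult s t \<in> plane_lines okubo okubo_mult"
    by (auto simp: plane_lines_def)
  ultimately show "pPhi_line (slope_line okubo okubo_mult s t)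
      = slope_line okubo para_oct_mult (okubo_tau s) t"
    by (simp add: pPhi_line_eq_image pPhi_point_slope_line)
next
  fix c assume "c \<in> okubo"
  then have "vert_line okubo c \<in> plane_lines okubo okubo_mult"
    by (auto simp: plane_lines_def)
  then show "pPhi_line (vert_line okubo c) = vert_line okubo (okubo_tau (okubo_tau c))"
    by (simp add: pPhi_line_eq_image pPhi_point_vert_line)
next
  have "inf_line okubo \<in> plane_lines okubo okubo_mult"
    by (simp add: plane_lines_def)
  then show "pPhi_line (inf_line okubo) = inf_line okubo"
    by (simp add: pPhi_line_eq_image pPhi_point_inf_line)
next
  show "plane_isomorphism
      (plane_points okubo) (plane_lines okubo okubo_mult)
      (plane_points okubo) (plane_lines okubo para_oct_mult)
      pPhi_point pPhi_line"
    by (rule plane_isomorphism_image[OF bij_betw_pPhi_point plane_lines_subset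
          pPhi_line_eq_image pPhi_point_image_lines])
qed

end
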